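(* Let $n,m\in\mathbb{N}$, let $S_1,S_2\in\mathbb{V}(X)$ be sets with $S_1$ completely coherent, let $\mathcal{U}\in\beta S_1$, $\mathcal{V}\in\beta S_2$, and let $\alpha\in\mu_n(\mathcal{U})$, $\beta\in\mu_m(\mathcal{V})$. Then $(\alpha,S_n(\beta))\in\mu_{n+m}(\mathcal{U}\otimes\mathcal{V})$.
   Context: Work in a single superstructure model $\langle\mathbb{V}(X),\mathbb{V}(X),\ast\rangle$ of nonstandard methods ($X$ infinite, $\ast$ a star map on $\mathbb{V}(X)$ satisfying transfer). Define $S_0=\mathrm{id}$, $S_{n+1}=\ast\circ S_n$. For an ultrafilter $\mathcal{W}$ on a set $Y$, $\mu_k(\mathcal{W})=\bigcap_{A\in\mathcal{W}}S_k(A)$. A set $Y$ is completely coherent if $A\subseteq{}^{\ast}A$ for every $A\subseteq Y$. The tensor product $\mathcal{U}\otimes\mathcal{V}$ is the ultrafilter on $S_1\times S_2$ with $A\in\mathcal{U}\otimes\mathcal{V}$ iff $\{s_1\in S_1\mid\{s_2\in S_2\mid (s_1,s_2)\in A\}\in\mathcal{V}\}\in\mathcal{U}$. *)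

theory Defs
  imports Main
begin

(* No HOL type can be constructed that provably contains a superstructure over an infinite
   set, so V(X) is given by a type with a membership relation E and a set X of atoms; the
   locale "superstructure" below determines (V(X), E) up to isomorphism over X. *)

definition ext :: "('v \<Rightarrow> 'v \<Rightarrow> bool) \<Rightarrow> 'v \<Rightarrow> 'v set" where
  "ext E a = {x. E x a}"

fun level :: "('v \<Rightarrow> 'v \<Rightarrow> bool) \<Rightarrow> 'v set \<Rightarrow> nat \<Rightarrow> 'v set" where
  "level E X 0 = X"
| "level E X (Suc n) = level E X n \<union> {a. a \<notin> X \<and> ext E a \<subseteq> level E X n}"

definition VV :: "('v \<Rightarrow> 'v \<Rightarrow> bool) \<Rightarrow> 'v set \<Rightarrow> 'v set" where
  "VV E X = (\<Union>n. level E X n)"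

locale superstructure =
  fixes E :: "'v \<Rightarrow> 'v \<Rightarrow> bool" and X :: "'v set"
  assumes atoms: "x \<in> X \<Longrightarrow> ext E x = {}"
    and extensional: "inj_on (ext E) (VV E X - X)"
    and powerset: "A \<subseteq> level E X n \<Longrightarrow> \<exists>a. a \<notin> X \<and> ext E a = A"

(* The element of V(X) representing a subset of some level; unspecified for other A. *)
definition code :: "('v \<Rightarrow> 'v \<Rightarrow> bool) \<Rightarrow> 'v set \<Rightarrow> 'v set \<Rightarrow> 'v" where
  "code E X A = (THE a. a \<in> VV E X - X \<and> ext E a = A)"

definition pair :: "('v \<Rightarrow> 'v \<Rightarrow> bool) \<Rightarrow> 'v set \<Rightarrow> 'v \<Rightarrow> 'v \<Rightarrow> 'v" where
  "pair E X a b = code E X {code E X {a}, code E X {a, b}}"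

(* Bounded formulas of the language with membership and equality.  Parameters from V(X)
   are supplied by the assignment; BAll i j p is the quantifier "for all v_i in v_j". *)
datatype bfm = Mem nat nat | Eq nat nat | Neg bfm | Conj bfm bfm | BAll nat nat bfm

primrec sat :: "('v \<Rightarrow> 'v \<Rightarrow> bool) \<Rightarrow> (nat \<Rightarrow> 'v) \<Rightarrow> bfm \<Rightarrow> bool" where
  "sat E e (Mem i j) \<longleftrightarrow> E (e i) (e j)"
| "sat E e (Eq i j) \<longleftrightarrow> e i = e j"
| "sat E e (Neg p) \<longleftrightarrow> \<not> sat E e p"
| "sat E e (Conj p q) \<longleftrightarrow> sat E e p \<and> sat E e q"
| "sat E e (BAll i j p) \<longleftrightarrow> (\<forall>a \<in> ext E (e j). sat E (e(i := a)) p)"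

locale single_superstructure_model = superstructure E X
  for E :: "'v \<Rightarrow> 'v \<Rightarrow> bool" and X :: "'v set" +
  fixes star :: "'v \<Rightarrow> 'v"
  assumes infinite_atoms: "infinite X"
    and star_closed: "a \<in> VV E X \<Longrightarrow> star a \<in> VV E X"
    and transfer: "range e \<subseteq> VV E X \<Longrightarrow> sat E e p \<longleftrightarrow> sat E (star \<circ> e) p"

definition completely_coherent ::
    "('v \<Rightarrow> 'v \<Rightarrow> bool) \<Rightarrow> 'v set \<Rightarrow> ('v \<Rightarrow> 'v) \<Rightarrow> 'v \<Rightarrow> bool" where
  "completely_coherent E X star Y \<longleftrightarrow>
     (\<forall>A. A \<subseteq> ext E Y \<longrightarrow> A \<subseteq> ext E (star (code E X A)))"

definition ultrafilter_on :: "'a set \<Rightarrow> 'a set set \<Rightarrow> bool" where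
  "ultrafilter_on Y W \<longleftrightarrow>
     W \<subseteq> Pow Y \<and> Y \<in> W \<and> {} \<notin> W \<and>
     (\<forall>A\<in>W. \<forall>B\<in>W. A \<inter> B \<in> W) \<and>
     (\<forall>A\<in>W. \<forall>B. A \<subseteq> B \<longrightarrow> B \<subseteq> Y \<longrightarrow> B \<in> W) \<and>
     (\<forall>A. A \<subseteq> Y \<longrightarrow> A \<in> W \<or> Y - A \<in> W)"

definition mu ::
    "('v \<Rightarrow> 'v \<Rightarrow> bool) \<Rightarrow> 'v set \<Rightarrow> ('v \<Rightarrow> 'v) \<Rightarrow> nat \<Rightarrow> 'v set set \<Rightarrow> 'v set" where
  "mu E X star k W = (\<Inter>A\<in>W. ext E ((star ^^ k) (code E X A)))"

definition cart :: "('v \<Rightarrow> 'v \<Rightarrow> bool) \<Rightarrow> 'v set \<Rightarrow> 'v \<Rightarrow> 'v \<Rightarrow> 'v set" where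
  "cart E X S T = {pair E X s t | s t. s \<in> ext E S \<and> t \<in> ext E T}"

definition tensor :: "('v \<Rightarrow> 'v \<Rightarrow> bool) \<Rightarrow> 'v set \<Rightarrow> 'v \<Rightarrow> 'v
    \<Rightarrow> 'v set set \<Rightarrow> 'v set set \<Rightarrow> 'v set set" where
  "tensor E X S T U V =
     {A. A \<subseteq> cart E X S T \<and>
         {s \<in> ext E S. {t \<in> ext E T. pair E X s t \<in> A} \<in> V} \<in> U}"

context superstructure
begin

lemma level_mono: "m \<le> n \<Longrightarrow> level E X m \<subseteq> level E X n"
  by (induction rule: dec_induct) auto

lemma ext_subset_level:
  assumes "a \<in> VV E X"
  shows "\<exists>n. ext E a \<subseteq> level E X n"
proof -
  have "a \<in> level E X n \<Longrightarrow> ext E a \<subseteq> level E X n" for n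
    by (induction n) (auto simp: atoms)
  then show ?thesis using assms by (auto simp: VV_def)
qed

lemma VV_transitive: "a \<in> VV E X \<Longrightarrow> x \<in> ext E a \<Longrightarrow> x \<in> VV E X"
  using ext_subset_level by (fastforce simp: VV_def)

lemma code_ext:
  assumes "a \<in> VV E X - X"
  shows "code E X (ext E a) = a"
  unfolding code_def
proof (rule the_equality)
  fix b assume "b \<in> VV E X - X \<and> ext E b = ext E a"
  then show "b = a" using inj_onD[OF extensional _ _ assms] by blast
qed (use assms in simp)

lemma code_props:
  assumes "A \<subseteq> level E X n"
  shows "code E X A \<in> level E X (Suc n)" "code E X A \<notin> X" "ext E (code E X A) = A"
proof -
  obtain a where a: "a \<notin> X" "ext E a = A" using powerset[OF assms] by blast
  have l: "a \<in> level E X (Suc n)" using a assms by simp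
  then have "a \<in> VV E X - X" unfolding VV_def using a by blast
  then have "code E X A = a" using code_ext a(2) by blast
  then show "code E X A \<in> level E X (Suc n)" "code E X A \<notin> X" "ext E (code E X A) = A"
    using a l by simp_all
qed

lemma code_subset:
  assumes "a \<in> VV E X" "A \<subseteq> ext E a"
  shows "code E X A \<in> VV E X - X" "ext E (code E X A) = A"
proof -
  obtain n where "A \<subseteq> level E X n" using ext_subset_level assms by blast
  from code_props[OF this] show "code E X A \<in> VV E X - X" "ext E (code E X A) = A"
    unfolding VV_def by blast+
qed

lemma two_in_level:
  assumes "a \<in> VV E X" "b \<in> VV E X"
  shows "\<exists>n. {a, b} \<subseteq> level E X n"
proof -
  obtain i j where "a \<in> level E X i" "b \<in> level E X j" using assms by (auto simp: VV_def)
  then have "{a, b} \<subseteq> level E X (max i j)"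
    using level_mono[of i "max i j"] level_mono[of j "max i j"] by auto
  then show ?thesis by blast
qed

lemma code_two:
  assumes "a \<in> VV E X" "b \<in> VV E X"
  shows "code E X {a, b} \<in> VV E X - X" "ext E (code E X {a, b}) = {a, b}"
proof -
  obtain n where "{a, b} \<subseteq> level E X n" using two_in_level assms by blast
  from code_props[OF this] show "code E X {a, b} \<in> VV E X - X"
      "ext E (code E X {a, b}) = {a, b}"
    unfolding VV_def by blast+
qed

lemma code_one:
  assumes "a \<in> VV E X"
  shows "code E X {a} \<in> VV E X - X" "ext E (code E X {a}) = {a}"
  using code_two[OF assms assms] by simp_all

lemma pair_VV:
  assumes "a \<in> VV E X" "b \<in> VV E X"
  shows "pair E X a b \<in> VV E X - X"
    and "ext E (pair E X a b) = {code E X {a}, code E X {a, b}}"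
  unfolding pair_def using code_two[of "code E X {a}" "code E X {a, b}"]
    code_one(1)[OF assms(1)] code_two(1)[OF assms] by auto

lemma pair_inject:
  assumes "a \<in> VV E X" "b \<in> VV E X" "c \<in> VV E X" "d \<in> VV E X"
  shows "pair E X a b = pair E X c d \<longleftrightarrow> a = c \<and> b = d"
proof
  assume "pair E X a b = pair E X c d"
  then have "ext E ` ext E (pair E X a b) = ext E ` ext E (pair E X c d)" by simp
  then have "{{a}, {a, b}} = {{c}, {c, d}}"
    by (simp add: pair_VV assms code_one code_two)
  then show "a = c \<and> b = d" by (auto simp: doubleton_eq_iff)
qed simp

lemma cart_VV:
  assumes "S \<in> VV E X" "T \<in> VV E X"
  shows "code E X (cart E X S T) \<in> VV E X - X"
    and "ext E (code E X (cart E X S T)) = cart E X S T"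
proof -
  obtain i j where ij: "ext E S \<subseteq> level E X i" "ext E T \<subseteq> level E X j"
    using ext_subset_level[OF assms(1)] ext_subset_level[OF assms(2)] by blast
  define n where "n = max i j"
  have ST: "ext E S \<subseteq> level E X n" "ext E T \<subseteq> level E X n"
    using ij level_mono[of i n] level_mono[of j n] by (auto simp: n_def)
  have "pair E X s t \<in> level E X (Suc (Suc n))" if "s \<in> ext E S" "t \<in> ext E T" for s t
  proof -
    have "code E X {s} \<in> level E X (Suc n)" "code E X {s, t} \<in> level E X (Suc n)"
      by (rule code_props(1), use ST that in blast)+
    then have "{code E X {s}, code E X {s, t}} \<subseteq> level E X (Suc n)" by blast
    then show ?thesis unfolding pair_def by (rule code_props(1))
  qed
  then have "cart E X S T \<subseteq> level E X (Suc (Suc n))" unfolding cart_def by blast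
  note c = code_props[OF this]
  show "code E X (cart E X S T) \<in> VV E X - X"
    using c(1,2) unfolding VV_def by blast
  show "ext E (code E X (cart E X S T)) = cart E X S T"
    by (fact c(3))
qed

lemma tensor_ultrafilter:
  assumes "S \<in> VV E X" "T \<in> VV E X"
    and U: "ultrafilter_on (ext E S) U" and V: "ultrafilter_on (ext E T) V"
  shows "ultrafilter_on (cart E X S T) (tensor E X S T U V)"
proof -
  define sec where "sec A s = {t \<in> ext E T. pair E X s t \<in> A}" for A s
  define big where "big A = {s \<in> ext E S. sec A s \<in> V}" for A
  have ten: "A \<in> tensor E X S T U V \<longleftrightarrow> A \<subseteq> cart E X S T \<and> big A \<in> U" for A
    by (simp add: tensor_def big_def sec_def)
  have U1: "ext E S \<in> U" "{} \<notin> U" "\<And>A B. A \<in> U \<Longrightarrow> B \<in> U \<Longrightarrow> A \<inter> B \<in> U"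
      "\<And>A B. A \<in> U \<Longrightarrow> A \<subseteq> B \<Longrightarrow> B \<subseteq> ext E S \<Longrightarrow> B \<in> U"
      "\<And>A. A \<subseteq> ext E S \<Longrightarrow> A \<in> U \<or> ext E S - A \<in> U"
    using U unfolding ultrafilter_on_def by blast+
  have V1: "ext E T \<in> V" "{} \<notin> V" "\<And>A B. A \<in> V \<Longrightarrow> B \<in> V \<Longrightarrow> A \<inter> B \<in> V"
      "\<And>A B. A \<in> V \<Longrightarrow> A \<subseteq> B \<Longrightarrow> B \<subseteq> ext E T \<Longrightarrow> B \<in> V"
      "\<And>A. A \<subseteq> ext E T \<Longrightarrow> A \<in> V \<or> ext E T - A \<in> V"
    using V unfolding ultrafilter_on_def by blast+
  have bigS: "big A \<subseteq> ext E S" for A by (auto simp: big_def)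
  have secT: "sec A s \<subseteq> ext E T" for A s by (auto simp: sec_def)
  have "sec (cart E X S T) s = ext E T" if "s \<in> ext E S" for s
    using that by (auto simp: sec_def cart_def)
  then have "big (cart E X S T) = ext E S" using V1(1) by (auto simp: big_def)
  then have 1: "cart E X S T \<in> tensor E X S T U V" using U1(1) by (simp add: ten)
  have "big {} = {}" using V1(2) by (auto simp: big_def sec_def)
  then have 2: "{} \<notin> tensor E X S T U V" using U1(2) by (simp add: ten)
  have mono: "big A \<subseteq> big B" if "A \<subseteq> B" for A B
  proof -
    have "sec A s \<subseteq> sec B s" for s using that by (auto simp: sec_def)
    then show ?thesis using V1(4) secT by (auto simp: big_def)
  qed
  have 3: "A \<inter> B \<in> tensor E X S T U V"
    if "A \<in> tensor E X S T U V" "B \<in> tensor E X S T U V" for A B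
  proof -
    have "sec (A \<inter> B) s = sec A s \<inter> sec B s" for s by (auto simp: sec_def)
    then have "big A \<inter> big B \<subseteq> big (A \<inter> B)" using V1(3) by (auto simp: big_def)
    moreover have "big A \<inter> big B \<in> U" using that U1(3) by (simp add: ten)
    ultimately have "big (A \<inter> B) \<in> U" using U1(4) bigS by blast
    then show ?thesis using that by (auto simp: ten)
  qed
  have 4: "A \<in> tensor E X S T U V \<or> cart E X S T - A \<in> tensor E X S T U V"
    if A: "A \<subseteq> cart E X S T" for A
  proof -
    have "sec (cart E X S T - A) s = ext E T - sec A s" if "s \<in> ext E S" for s
      using that by (auto simp: sec_def cart_def)
    then have sub: "ext E S - big A \<subseteq> big (cart E X S T - A)"
      unfolding big_def using V1(5)[OF secT[of A]] by force
    show ?thesis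
    proof (cases "big A \<in> U")
      case False
      then have "ext E S - big A \<in> U" using U1(5)[OF bigS] by blast
      then have "big (cart E X S T - A) \<in> U" using U1(4) sub bigS by blast
      then show ?thesis by (simp add: ten)
    qed (simp add: ten A)
  qed
  have 5: "B \<in> tensor E X S T U V"
    if "A \<in> tensor E X S T U V" "A \<subseteq> B" "B \<subseteq> cart E X S T" for A B
    using that(1,3) U1(4)[OF _ mono[OF that(2)] bigS] by (simp add: ten)
  have 6: "tensor E X S T U V \<subseteq> Pow (cart E X S T)" by (auto simp: ten)
  show ?thesis unfolding ultrafilter_on_def
    by (intro conjI ballI allI impI) (fact 6, fact 1, fact 2, rule 3, assumption+, rule 5,
      assumption+, rule 4, assumption)
qed

end

end

theory Submission
  imports Defs
begin

text \<open>
  Writing \<open>A\<^sub>s\<close> for the fiber of \<open>A\<close> over \<open>s\<close>, transfer of \<open>{s} \<times> A\<^sub>s \<subseteq> A\<close> along \<open>S\<^sub>m\<close> gives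
  \<open>(S\<^sub>m(s), \<beta>) \<in> S\<^sub>m(A)\<close> whenever \<open>A\<^sub>s\<close> lies in \<open>V\<close>. Complete coherence, applied to singletons, says
  that \<open>S\<^sub>m(s) = s\<close> for \<open>s\<close> in \<open>S\<^sub>1\<close>. So \<open>B \<times> {\<beta>} \<subseteq> S\<^sub>m(A)\<close>, where \<open>B\<close> is the set of all
  \<open>s\<close> with \<open>A\<^sub>s\<close> in \<open>V\<close>, and transfer of this inclusion along \<open>S\<^sub>n\<close> yields the claim.
\<close>

definition BEx :: "nat \<Rightarrow> nat \<Rightarrow> bfm \<Rightarrow> bfm" where
  "BEx i j p = Neg (BAll i j (Neg p))"

definition Disj :: "bfm \<Rightarrow> bfm \<Rightarrow> bfm" where
  "Disj p q = Neg (Conj (Neg p) (Neg q))"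

text \<open>The index \<open>i + j + k + 1\<close> serves as a bound variable distinct from \<open>i\<close>, \<open>j\<close> and \<open>k\<close>.\<close>

definition Eq_Doubleton :: "nat \<Rightarrow> nat \<Rightarrow> nat \<Rightarrow> bfm" where
  "Eq_Doubleton i j k = (let w = i + j + k + 1 in
     Conj (Conj (Mem j i) (Mem k i)) (BAll w i (Disj (Eq w j) (Eq w k))))"

definition Pair_Mem :: "nat \<Rightarrow> nat \<Rightarrow> nat \<Rightarrow> bfm" where
  "Pair_Mem i j k = (let z = i + j + k + 1; u = z + 1; v = z + 2 in
     BEx z k (BEx u z (BEx v z
       (Conj (Eq_Doubleton z u v) (Conj (Eq_Doubleton u i i) (Eq_Doubleton v i j))))))"

lemma sat_BEx [simp]: "sat E e (BEx i j p) \<longleftrightarrow> (\<exists>a \<in> ext E (e j). sat E (e(i := a)) p)"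
  by (simp add: BEx_def)

lemma sat_Disj [simp]: "sat E e (Disj p q) \<longleftrightarrow> sat E e p \<or> sat E e q"
  by (simp add: Disj_def)

lemma sat_Eq_Doubleton [simp]:
  "sat E e (Eq_Doubleton i j k) \<longleftrightarrow> ext E (e i) = {e j, e k}"
proof -
  have "sat E e (Eq_Doubleton i j k) \<longleftrightarrow>
      e j \<in> ext E (e i) \<and> e k \<in> ext E (e i) \<and> (\<forall>w \<in> ext E (e i). w = e j \<or> w = e k)"
    by (simp add: Eq_Doubleton_def ext_def)
  also have "\<dots> \<longleftrightarrow> ext E (e i) = {e j, e k}"
    by auto
  finally show ?thesis .
qed

lemma mem_mu_iff: "a \<in> mu E X star k W \<longleftrightarrow> (\<forall>A \<in> W. a \<in> ext E ((star ^^ k) (code E X A)))"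
  by (simp add: mu_def)

context superstructure
begin

text \<open>The doubleton is nonempty, which rules out that \<open>c\<close> is an atom.\<close>

lemma ext_eq_doubleton_iff:
  assumes "a \<in> VV E X" "b \<in> VV E X" "c \<in> VV E X"
  shows "ext E c = {a, b} \<longleftrightarrow> c = code E X {a, b}"
proof
  assume ext: "ext E c = {a, b}"
  then have "c \<in> VV E X - X" using assms(3) atoms by blast
  from code_ext[OF this] show "c = code E X {a, b}" by (simp add: ext)
qed (simp add: code_two assms)

lemma eq_pair_iff:
  assumes "a \<in> VV E X" "b \<in> VV E X" "z \<in> VV E X"
  shows "z = pair E X a b \<longleftrightarrow>
    (\<exists>u \<in> ext E z. \<exists>v \<in> ext E z. ext E z = {u, v} \<and> ext E u = {a} \<and> ext E v = {a, b})"
proof -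
  have "z = pair E X a b \<longleftrightarrow> ext E z = {code E X {a}, code E X {a, b}}"
    using assms code_one(1) code_two(1) by (simp add: pair_def ext_eq_doubleton_iff)
  also have "\<dots> \<longleftrightarrow>
      (\<exists>u \<in> ext E z. \<exists>v \<in> ext E z. ext E z = {u, v} \<and> u = code E X {a} \<and> v = code E X {a, b})"
    by auto
  also have "\<dots> \<longleftrightarrow>
      (\<exists>u \<in> ext E z. \<exists>v \<in> ext E z. ext E z = {u, v} \<and> ext E u = {a} \<and> ext E v = {a, b})"
    using assms VV_transitive ext_eq_doubleton_iff[of a a] ext_eq_doubleton_iff[of a b]
    by (intro bex_cong refl) simp
  finally show ?thesis .
qed

lemma sat_Pair_Mem:
  assumes "e i \<in> VV E X" "e j \<in> VV E X" "e k \<in> VV E X"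
  shows "sat E e (Pair_Mem i j k) \<longleftrightarrow> pair E X (e i) (e j) \<in> ext E (e k)"
proof -
  have "sat E e (Pair_Mem i j k) \<longleftrightarrow>
      (\<exists>z \<in> ext E (e k). \<exists>u \<in> ext E z. \<exists>v \<in> ext E z.
        ext E z = {u, v} \<and> ext E u = {e i} \<and> ext E v = {e i, e j})"
    by (simp add: Pair_Mem_def Let_def)
  also have "\<dots> \<longleftrightarrow> (\<exists>z \<in> ext E (e k). z = pair E X (e i) (e j))"
    using assms VV_transitive by (intro bex_cong refl eq_pair_iff[symmetric]) auto
  finally show ?thesis by simp
qed

definition fiber :: "'v \<Rightarrow> 'v set \<Rightarrow> 'v \<Rightarrow> 'v set" where
  "fiber T A s = {t \<in> ext E T. pair E X s t \<in> A}"

lemma fiber_subset: "fiber T A s \<subseteq> ext E T"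
  by (auto simp: fiber_def)

lemma mem_tensor_iff:
  "A \<in> tensor E X S T U V \<longleftrightarrow>
     A \<subseteq> cart E X S T \<and> {s \<in> ext E S. fiber T A s \<in> V} \<in> U"
  by (simp add: tensor_def fiber_def)

lemma code_subset_cart:
  assumes "S \<in> VV E X" "T \<in> VV E X" "A \<subseteq> cart E X S T"
  shows "code E X A \<in> VV E X" "ext E (code E X A) = A"
  using code_subset[of "code E X (cart E X S T)" A] cart_VV[OF assms(1,2)] assms(3) by auto

end

context single_superstructure_model
begin

lemma funpow_star_closed: "a \<in> VV E X \<Longrightarrow> (star ^^ k) a \<in> VV E X"
  by (induction k) (auto simp: star_closed)

lemma range_funpow_star_comp:
  "range e \<subseteq> VV E X \<Longrightarrow> range ((star ^^ k) \<circ> e) \<subseteq> VV E X"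
  using funpow_star_closed by fastforce

lemma funpow_transfer:
  assumes "range e \<subseteq> VV E X"
  shows "sat E e p \<longleftrightarrow> sat E ((star ^^ k) \<circ> e) p"
proof (induction k)
  case (Suc k)
  from transfer[OF range_funpow_star_comp[OF assms]] Suc show ?case
    by (simp only: funpow.simps comp_assoc)
qed simp

lemma ext_funpow_star_singleton:
  assumes "a \<in> VV E X"
  shows "ext E ((star ^^ k) (code E X {a})) = {(star ^^ k) a}"
proof -
  let ?e = "(\<lambda>_. a)(0 := code E X {a})" and ?p = "Eq_Doubleton 0 1 1"
  have "range ?e \<subseteq> VV E X" using assms code_one(1) by auto
  moreover have "sat E ?e ?p" using assms by (simp add: code_one)
  ultimately have "sat E ((star ^^ k) \<circ> ?e) ?p" using funpow_transfer by blast
  then show ?thesis by simp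
qed

lemma funpow_star_cart_subset_iff:
  assumes "A \<in> VV E X" "B \<in> VV E X" "C \<in> VV E X"
  shows "cart E X ((star ^^ k) B) ((star ^^ k) C) \<subseteq> ext E ((star ^^ k) A) \<longleftrightarrow>
    cart E X B C \<subseteq> ext E A"
proof -
  let ?p = "BAll 0 3 (BAll 1 4 (Pair_Mem 0 1 2))"
  let ?e = "(\<lambda>_. A)(3 := B, 4 := C)"
  have sat_iff: "sat E e ?p \<longleftrightarrow> cart E X (e 3) (e 4) \<subseteq> ext E (e 2)"
    if "range e \<subseteq> VV E X" for e :: "nat \<Rightarrow> 'v"
  proof -
    have "e i \<in> VV E X" for i using that by blast
    moreover from this have "x \<in> VV E X" if "x \<in> ext E (e i)" for x i
      using that VV_transitive by blast
    ultimately have "sat E e ?p \<longleftrightarrow>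
        (\<forall>b \<in> ext E (e 3). \<forall>c \<in> ext E (e 4). pair E X b c \<in> ext E (e 2))"
      by (simp add: sat_Pair_Mem)
    then show ?thesis by (auto simp: cart_def)
  qed
  have range_e: "range ?e \<subseteq> VV E X" using assms by auto
  from funpow_transfer[OF range_e, of ?p] show ?thesis
    unfolding sat_iff[OF range_e] sat_iff[OF range_funpow_star_comp[OF range_e]] by simp
qed

corollary pair_mem_funpow_star:
  assumes "A \<in> VV E X" "B \<in> VV E X" "C \<in> VV E X" "cart E X B C \<subseteq> ext E A"
    and "b \<in> ext E ((star ^^ k) B)" "c \<in> ext E ((star ^^ k) C)"
  shows "pair E X b c \<in> ext E ((star ^^ k) A)"
proof -
  have "pair E X b c \<in> cart E X ((star ^^ k) B) ((star ^^ k) C)"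
    using assms(5,6) by (auto simp: cart_def)
  then show ?thesis using funpow_star_cart_subset_iff[OF assms(1-3)] assms(4) by blast
qed

lemma completely_coherent_imp_funpow_star_fixed:
  assumes "completely_coherent E X star Y" "Y \<in> VV E X" "s \<in> ext E Y"
  shows "(star ^^ k) s = s"
proof -
  have "s \<in> VV E X" using VV_transitive assms(2,3) by blast
  then have "ext E (star (code E X {s})) = {star s}"
    using ext_funpow_star_singleton[of s 1] by simp
  moreover have "s \<in> ext E (star (code E X {s}))"
    using assms(1,3) unfolding completely_coherent_def by blast
  ultimately have "star s = s" by simp
  then show ?thesis by (induction k) simp_all
qed

lemma mu_subset_VV:
  assumes "Y \<in> VV E X" "ext E Y \<in> W"
  shows "mu E X star k W \<subseteq> VV E X"
proof
  fix a assume "a \<in> mu E X star k W"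
  then have "a \<in> ext E ((star ^^ k) (code E X (ext E Y)))" using assms(2) by (simp add: mem_mu_iff)
  moreover have "code E X (ext E Y) \<in> VV E X" using code_subset(1)[OF assms(1)] by blast
  ultimately show "a \<in> VV E X" using VV_transitive funpow_star_closed by blast
qed

lemma pair_funpow_star_mu_mem:
  assumes "A \<in> VV E X" "T \<in> VV E X" "s \<in> VV E X"
    and "fiber T (ext E A) s \<in> V" "\<beta> \<in> mu E X star k V"
  shows "pair E X ((star ^^ k) s) \<beta> \<in> ext E ((star ^^ k) A)"
proof -
  let ?F = "code E X (fiber T (ext E A) s)"
  note F = code_subset[OF assms(2) fiber_subset, of "ext E A" s]
  have "cart E X (code E X {s}) ?F \<subseteq> ext E A"
    using F(2) code_one(2)[OF assms(3)] by (auto simp: cart_def fiber_def)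
  moreover have "(star ^^ k) s \<in> ext E ((star ^^ k) (code E X {s}))"
    using ext_funpow_star_singleton[OF assms(3)] by simp
  moreover have "\<beta> \<in> ext E ((star ^^ k) ?F)" using assms(4,5) by (simp add: mem_mu_iff)
  ultimately show ?thesis
    using pair_mem_funpow_star assms(1) code_one(1)[OF assms(3)] F(1) by blast
qed

lemma pair_mu_funpow_star_mem:
  assumes "A \<in> VV E X" "S \<in> VV E X" "b \<in> VV E X"
    and "B \<subseteq> ext E S" "B \<in> U" "\<alpha> \<in> mu E X star k U"
    and "\<And>s. s \<in> B \<Longrightarrow> pair E X s b \<in> ext E A"
  shows "pair E X \<alpha> ((star ^^ k) b) \<in> ext E ((star ^^ k) A)"
proof -
  note B = code_subset[OF assms(2,4)]
  have "cart E X (code E X B) (code E X {b}) \<subseteq> ext E A"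
    using B(2) code_one(2)[OF assms(3)] assms(7) by (auto simp: cart_def)
  moreover have "\<alpha> \<in> ext E ((star ^^ k) (code E X B))" using assms(5,6) by (simp add: mem_mu_iff)
  moreover have "(star ^^ k) b \<in> ext E ((star ^^ k) (code E X {b}))"
    using ext_funpow_star_singleton[OF assms(3)] by simp
  ultimately show ?thesis
    using pair_mem_funpow_star assms(1) B(1) code_one(1)[OF assms(3)] by blast
qed

lemma pair_mem_mu_tensor:
  assumes "S \<in> VV E X" "T \<in> VV E X" "completely_coherent E X star S" "ext E T \<in> V"
    and \<alpha>: "\<alpha> \<in> mu E X star n U" and \<beta>: "\<beta> \<in> mu E X star m V"
  shows "pair E X \<alpha> ((star ^^ n) \<beta>) \<in> mu E X star (n + m) (tensor E X S T U V)"
  unfolding mem_mu_iff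
proof
  fix A assume A: "A \<in> tensor E X S T U V"
  define a where "a = code E X A"
  define B where "B = {s \<in> ext E S. fiber T A s \<in> V}"
  have "A \<subseteq> cart E X S T" and B: "B \<in> U"
    using A by (simp_all add: mem_tensor_iff B_def)
  then have a: "a \<in> VV E X" "ext E a = A"
    using code_subset_cart assms(1,2) by (simp_all add: a_def)
  have pair_mem: "pair E X s \<beta> \<in> ext E ((star ^^ m) a)" if "s \<in> B" for s
  proof -
    have s: "s \<in> ext E S" "fiber T (ext E a) s \<in> V" using that by (simp_all add: B_def a(2))
    then have "s \<in> VV E X" using VV_transitive assms(1) by blast
    then have "pair E X ((star ^^ m) s) \<beta> \<in> ext E ((star ^^ m) a)"
      using pair_funpow_star_mu_mem a(1) assms(2) s(2) \<beta> by blast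
    then show ?thesis using completely_coherent_imp_funpow_star_fixed assms(1,3) s(1) by simp
  qed
  have "\<beta> \<in> VV E X" using mu_subset_VV assms(2,4) \<beta> by blast
  moreover have "B \<subseteq> ext E S" by (auto simp: B_def)
  ultimately have "pair E X \<alpha> ((star ^^ n) \<beta>) \<in> ext E ((star ^^ n) ((star ^^ m) a))"
    by (rule pair_mu_funpow_star_mem[OF funpow_star_closed[OF a(1)] assms(1) _ _ B \<alpha> pair_mem])
  then show "pair E X \<alpha> ((star ^^ n) \<beta>) \<in> ext E ((star ^^ (n + m)) (code E X A))"
    by (simp add: funpow_add a_def)
qed

end

theorem theorem4p13:
  fixes E :: "'v \<Rightarrow> 'v \<Rightarrow> bool" and X :: "'v set" and star :: "'v \<Rightarrow> 'v"
    and n m :: nat and S1 S2 \<alpha> \<beta> :: 'v and U V :: "'v set set"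
  assumes "single_superstructure_model E X star"
    and "S1 \<in> VV E X - X" and "S2 \<in> VV E X - X"
    and "completely_coherent E X star S1"
    and "ultrafilter_on (ext E S1) U" and "ultrafilter_on (ext E S2) V"
    and "\<alpha> \<in> mu E X star n U" and "\<beta> \<in> mu E X star m V"
  shows "pair E X \<alpha> ((star ^^ n) \<beta>) \<in> mu E X star (n + m) (tensor E X S1 S2 U V)"
proof -
  interpret single_superstructure_model E X star by (fact assms(1))
  have "ext E S2 \<in> V" using assms(6) by (simp add: ultrafilter_on_def)
  then show ?thesis using pair_mem_mu_tensor assms by blast
qed

end
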